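(* Let $f:\mathbb{R}^n\times\mathbb{R}_{\ge 0}\to\mathbb{R}$ satisfy the standing assumptions (A1)–(A3) given in the context, with constants $0<m\le M$ and $K_1,K_2,K_3\ge 0$. Let $\delta>0$, $\epsilon>0$, $0<\alpha\le \frac{1}{2M}$, $t_0\ge 0$, $t_{k}=t_0+k\delta$, and $\mathbf{x}_0\in\mathbb{R}^n$, and let $(\mathbf{x}_k)_{k\ge 0}$ be the sequence generated by Algorithm 1 (defined in the context) from $\mathbf{x}_0$. Put $$\kappa=1-\frac{\alpha M}{2},\qquad \psi=\delta\Big(K_1+\frac{\delta}{2}K_3\Big)+\frac{K_2^2\delta^2}{2m}\Big(\frac{M\delta}{m}+2\Big),$$ $$\gamma=\frac{2K_1}{\delta}+\frac{M}{2\epsilon^2}K_1^2+\frac12K_3+\frac1\epsilon K_1K_2,\qquad \mu=K_1+\frac{\delta}{2}K_3 .$$ Then Algorithm 1 converges to a neighborhood of the optimal solution in the sense that, for every integer $k\ge 1$, $$f(\mathbf{x}_{k+1},t_{k+1})-f^\star(t_{k+1})\le \frac{1-(1-2\kappa\alpha m)^k}{4\kappa^2\alpha^2m}\,\psi+\frac{1-(1-2\kappa\alpha m)^k}{4\kappa^2\alpha^2m^2}\,\max(\gamma\delta^2,\mu\delta)+(1-2\kappa\alpha m)^k\big(f(\mathbf{x}_0,t_0)-f^\star(t_0)\big).$$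
   Context: Notation: $\|\cdot\|$ is the Euclidean norm; $\nabla_{\mathbf{x}}f$, $\nabla_t f$ are the partial derivatives of $f(\mathbf{x},t)$ with respect to $\mathbf{x}$ and $t$; $\nabla_{\mathbf{x}\mathbf{x}}f$ and $\nabla_{\mathbf{x}t}f$ are the partial derivatives of $\nabla_{\mathbf{x}}f$ with respect to $\mathbf{x}$ and $t$; $\nabla_{tt}f$ is the second partial derivative in $t$. Problem: for each $t\ge 0$, $\mathbf{x}^\star(t)=\arg\min_{\mathbf{x}\in\mathbb{R}^n}f(\mathbf{x},t)$ and $f^\star(t)=f(\mathbf{x}^\star(t),t)$. Standing assumptions: (A1) For every $t\ge0$ and $\mathbf{x}\in\mathbb{R}^n$, $f(\mathbf{x},t)$ is finite, and the minimization problem at time $t$ is solvable with finite minimum value. (A2) $f$ is twice continuously differentiable in $\mathbf{x}$, continuously differentiable in $t$ and globally Lipschitz in $t$, and $m\,\mathbf{I}_n\preceq\nabla_{\mathbf{x}\mathbf{x}}f(\mathbf{x},t)\preceq M\,\mathbf{I}_n$ for all $\mathbf{x}\in\mathbb{R}^n$, $t\ge0$ (so the minimizer is unique). (A3) $f$ is sufficiently smooth (jointly twice continuously differentiable in $(\mathbf{x},t)$), and $|\nabla_t f(\mathbf{x},t)|\le K_1$, $\|\nabla_{\mathbf{x}t}f(\mathbf{x},t)\|\le K_2$, $|\nabla_{tt}f(\mathbf{x},t)|\le K_3$ for all $\mathbf{x}\in\mathbb{R}^n$, $t\ge 0$. Algorithm 1 (parameters $\epsilon,\delta,\alpha>0$):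 given $\mathbf{x}_k$, the prediction step sets $$\mathbf{x}^-_{k+1}=\begin{cases}\mathbf{x}_k-\delta\,\dfrac{|\nabla_t f(\mathbf{x}_k,t_k)|}{\|\nabla_{\mathbf{x}}f(\mathbf{x}_k,t_k)\|^2}\,\nabla_{\mathbf{x}}f(\mathbf{x}_k,t_k), & \|\nabla_{\mathbf{x}}f(\mathbf{x}_k,t_k)\|\ge\epsilon,\\[2mm] \mathbf{x}_k,&\text{otherwise,}\end{cases}$$ and the update step sets $\mathbf{x}_{k+1}=\mathbf{x}^-_{k+1}-\alpha\nabla_{\mathbf{x}}f(\mathbf{x}^-_{k+1},t_{k+1})$. *)

theory Defs
  imports "HOL-Analysis.Analysis"
begin

definition cont_diff_on ::
    "'a::real_normed_vector set \<Rightarrow> ('a \<Rightarrow> 'b::real_normed_vector) \<Rightarrow> bool" where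
  "cont_diff_on S F \<longleftrightarrow>
     (\<exists>F' :: 'a \<Rightarrow> 'a \<Rightarrow>\<^sub>L 'b.
        (\<forall>z\<in>S. (F has_derivative blinfun_apply (F' z)) (at z within S)) \<and>
        continuous_on S F')"

definition twice_cont_diff_on ::
    "'a::real_normed_vector set \<Rightarrow> ('a \<Rightarrow> 'b::real_normed_vector) \<Rightarrow> bool" where
  "twice_cont_diff_on S F \<longleftrightarrow>
     (\<exists>F' :: 'a \<Rightarrow> 'a \<Rightarrow>\<^sub>L 'b.
        (\<forall>z\<in>S. (F has_derivative blinfun_apply (F' z)) (at z within S)) \<and>
        cont_diff_on S F')"

(* Time ranges over {0..}, so derivatives in t are taken within {0..}: ordinary derivatives
   for t > 0 and one-sided at t = 0.  Values of f at negative times are never used. *)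

definition grad_x :: "(real^'n \<Rightarrow> real \<Rightarrow> real) \<Rightarrow> real^'n \<Rightarrow> real \<Rightarrow> real^'n" where
  "grad_x f x t = (THE D. GDERIV (\<lambda>y. f y t) x :> D)"

definition deriv_t :: "(real^'n \<Rightarrow> real \<Rightarrow> real) \<Rightarrow> real^'n \<Rightarrow> real \<Rightarrow> real" where
  "deriv_t f x t = vector_derivative (f x) (at t within {0..})"

definition hess_xx :: "(real^'n \<Rightarrow> real \<Rightarrow> real) \<Rightarrow> real^'n \<Rightarrow> real \<Rightarrow> real^'n^'n" where
  "hess_xx f x t = jacobian (\<lambda>y. grad_x f y t) (at x)"

definition deriv_xt :: "(real^'n \<Rightarrow> real \<Rightarrow> real) \<Rightarrow> real^'n \<Rightarrow> real \<Rightarrow> real^'n" where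
  "deriv_xt f x t = vector_derivative (grad_x f x) (at t within {0..})"

definition deriv_tt :: "(real^'n \<Rightarrow> real \<Rightarrow> real) \<Rightarrow> real^'n \<Rightarrow> real \<Rightarrow> real" where
  "deriv_tt f x t = vector_derivative (deriv_t f x) (at t within {0..})"

(* Loewner order.  Symmetry is not demanded: it holds for mat c and for the Hessian of a
   twice continuously differentiable function. *)
definition loewner_le :: "real^'n^'n \<Rightarrow> real^'n^'n \<Rightarrow> bool" (infix \<open>\<preceq>\<close> 50) where
  "A \<preceq> B \<longleftrightarrow> (\<forall>v. 0 \<le> v \<bullet> ((B - A) *v v))"

definition x_opt :: "(real^'n \<Rightarrow> real \<Rightarrow> real) \<Rightarrow> real \<Rightarrow> real^'n" where
  "x_opt f t = arg_min (\<lambda>x. f x t) (\<lambda>_. True)"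

definition f_opt :: "(real^'n \<Rightarrow> real \<Rightarrow> real) \<Rightarrow> real \<Rightarrow> real" where
  "f_opt f t = f (x_opt f t) t"

definition predict ::
    "(real^'n \<Rightarrow> real \<Rightarrow> real) \<Rightarrow> real \<Rightarrow> real \<Rightarrow> real^'n \<Rightarrow> real \<Rightarrow> real^'n" where
  "predict f \<epsilon> \<delta> x t =
     (if norm (grad_x f x t) \<ge> \<epsilon>
      then x - (\<delta> * (\<bar>deriv_t f x t\<bar> / (norm (grad_x f x t))\<^sup>2)) *\<^sub>R grad_x f x t
      else x)"

definition update ::
    "(real^'n \<Rightarrow> real \<Rightarrow> real) \<Rightarrow> real \<Rightarrow> real^'n \<Rightarrow> real \<Rightarrow> real^'n" where
  "update f \<alpha> x t = x - \<alpha> *\<^sub>R grad_x f x t"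

definition sample_time :: "real \<Rightarrow> real \<Rightarrow> nat \<Rightarrow> real" where
  "sample_time t0 \<delta> k = t0 + real k * \<delta>"

primrec iterate ::
    "(real^'n \<Rightarrow> real \<Rightarrow> real) \<Rightarrow> real \<Rightarrow> real \<Rightarrow> real \<Rightarrow> real \<Rightarrow> real^'n \<Rightarrow> nat \<Rightarrow> real^'n" where
  "iterate f \<epsilon> \<delta> \<alpha> t0 x0 0 = x0"
| "iterate f \<epsilon> \<delta> \<alpha> t0 x0 (Suc k) =
     update f \<alpha>
       (predict f \<epsilon> \<delta> (iterate f \<epsilon> \<delta> \<alpha> t0 x0 k) (sample_time t0 \<delta> k))
       (sample_time t0 \<delta> (Suc k))"

end

theory Submission
  imports Defs
begin

text \<open>Sampling moves $f$ and $f^\star$ by at most $K_1\delta$ each, and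
  the prediction step adds at most $\frac{M}{2\epsilon^2} K_1^2 \delta^2$, since its linear term is a
  descent. So prediction raises the gap by at most $\gamma\delta^2$, whereas the update multiplies it
  by at most $\rho = 1 - 2\kappa\alpha m$ (descent lemma and Polyak--Lojasiewicz inequality). Summing
  the geometric series leaves $\rho^k (f(x_0,t_0) - f^\star(t_0)) + \gamma\delta^2/(1-\rho)$, and
  $1/(1-\rho) \le (1-\rho^k)/(1-\rho)^2$ for $k \ge 1$.\<close>

section \<open>Second-order Taylor expansion, gradient and Hessian\<close>

text \<open>Restricting \<open>\<phi>\<close> to the segment from \<open>x\<close> to
  \<open>y\<close> reduces this to the one-variable expansion with Lagrange remainder;
  \<open>z\<close> is the intermediate point on the segment.\<close>

lemma second_order_taylor_gradient:
  fixes \<phi> :: "'a::real_inner \<Rightarrow> real"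
  assumes g: "\<And>y. GDERIV \<phi> y :> g y"
    and g': "\<And>y. (g has_derivative g' y) (at y)"
  shows "\<exists>z. \<phi> y = \<phi> x + g x \<bullet> (y - x) + ((y - x) \<bullet> g' z (y - x)) / 2"
proof -
  define v where "v = y - x"
  \<comment> \<open>For \<open>n\<close> at most 2, \<open>D n\<close> is the derivative of order
    \<open>n\<close> of \<open>\<phi>\<close> along the segment. The last branch is only a filler
    for larger \<open>n\<close>, since the expansion stops at order 2.\<close>
  define D where "D n u = (if n = 0 then \<phi> (x + u *\<^sub>R v) else if n = 1 then g (x + u *\<^sub>R v) \<bullet> v
     else v \<bullet> g' (x + u *\<^sub>R v) v)" for n :: nat and u :: real
  have line: "((\<lambda>u. x + u *\<^sub>R v) has_derivative (\<lambda>h. h *\<^sub>R v)) (at u)" for u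
    by (auto intro!: derivative_eq_intros)
  have "DERIV (D 0) u :> D 1 u" for u
  proof -
    have "((\<lambda>u. \<phi> (x + u *\<^sub>R v)) has_derivative (\<lambda>h. g (x + u *\<^sub>R v) \<bullet> (h *\<^sub>R v))) (at u)"
      using has_derivative_compose[OF line g[unfolded gderiv_def]]
      by (simp add: inner_commute)
    then show ?thesis
      by (simp add: D_def[abs_def] has_field_derivative_def mult.commute[of "_ \<bullet> _"] mult_commute_abs)
  qed
  moreover have "DERIV (D 1) u :> D 2 u" for u
  proof -
    have lin: "linear (g' (x + u *\<^sub>R v))"
      using g' has_derivative_linear by blast
    have "((\<lambda>u. g (x + u *\<^sub>R v) \<bullet> v) has_derivative (\<lambda>h. g' (x + u *\<^sub>R v) (h *\<^sub>R v) \<bullet> v)) (at u)"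
      by (intro has_derivative_inner_left has_derivative_compose[OF line g'])
    then show ?thesis
      by (simp add: D_def[abs_def] has_field_derivative_def linear_scale[OF lin] inner_commute
          mult_commute_abs)
  qed
  ultimately have "\<forall>n u. n < 2 \<and> 0 \<le> u \<and> u \<le> 1 \<longrightarrow> DERIV (D n) u :> D (Suc n) u"
    by (auto simp: less_Suc_eq numeral_2_eq_2)
  then obtain u where "D 0 1 = (\<Sum>n<2. D n 0 / fact n * 1 ^ n) + D 2 u / fact 2 * 1 ^ 2"
    using Maclaurin2[of 1 D "D 0" 2] by auto
  then have "\<phi> y = \<phi> x + g x \<bullet> v + (v \<bullet> g' (x + u *\<^sub>R v) v) / 2"
    by (simp add: D_def numeral_2_eq_2 v_def)
  then show ?thesis
    unfolding v_def by blast
qed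

lemma grad_x_eqI:
  assumes "GDERIV (\<lambda>y. f y s) x :> D"
  shows "grad_x f x s = D"
proof -
  have "D' = D" if "GDERIV (\<lambda>y. f y s) x :> D'" for D'
    using has_derivative_unique[OF assms[unfolded gderiv_def] that[unfolded gderiv_def]]
    by (metis inner_commute vector_eq_rdot)
  with assms show ?thesis
    unfolding grad_x_def by blast
qed

text \<open>Twice differentiability is given through bounded linear functionals. The Riesz vector of
  the first derivative is the gradient, and it depends linearly on that functional, so
  differentiability carries over to \<open>grad_x\<close>.\<close>

lemma
  assumes "twice_cont_diff_on UNIV (\<lambda>y. f y s)"
  shows GDERIV_grad_x: "GDERIV (\<lambda>y. f y s) x :> grad_x f x s" (is ?gradient)
    and has_derivative_grad_x:
      "((\<lambda>y. grad_x f y s) has_derivative (*v) (hess_xx f x s)) (at x)" (is ?hessian)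
proof -
  from assms obtain F' F'' where
    F': "\<And>y. ((\<lambda>y. f y s) has_derivative blinfun_apply (F' y)) (at y)"
    and F'': "\<And>y. (F' has_derivative blinfun_apply (F'' y)) (at y)"
    unfolding twice_cont_diff_on_def cont_diff_on_def by auto
  have "blinfun_apply (F' y) = (\<lambda>h. h \<bullet> (\<Sum>b\<in>Basis. blinfun_apply (F' y) b *\<^sub>R b))" for y
  proof
    fix h
    have "blinfun_apply (F' y) h = blinfun_apply (F' y) (\<Sum>b\<in>Basis. (h \<bullet> b) *\<^sub>R b)"
      by (simp add: euclidean_representation)
    also have "\<dots> = h \<bullet> (\<Sum>b\<in>Basis. blinfun_apply (F' y) b *\<^sub>R b)"
      by (simp add: blinfun.sum_right blinfun.scaleR_right inner_sum_right mult.commute)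
    finally show "blinfun_apply (F' y) h = h \<bullet> (\<Sum>b\<in>Basis. blinfun_apply (F' y) b *\<^sub>R b)" .
  qed
  then have G: "GDERIV (\<lambda>y. f y s) y :> (\<Sum>b\<in>Basis. blinfun_apply (F' y) b *\<^sub>R b)" for y
    using F'[of y] by (simp add: gderiv_def)
  then have eq: "grad_x f y s = (\<Sum>b\<in>Basis. blinfun_apply (F' y) b *\<^sub>R b)" for y
    by (rule grad_x_eqI)
  show ?gradient
    using G eq by simp
  have "((\<lambda>y. \<Sum>b\<in>Basis. blinfun_apply (F' y) b *\<^sub>R b) has_derivative
      (\<lambda>h. \<Sum>b\<in>Basis. blinfun_apply (blinfun_apply (F'' x) h) b *\<^sub>R b)) (at x)"
    by (auto intro!: derivative_eq_intros F'')
  then have "(\<lambda>y. grad_x f y s) differentiable at x"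
    unfolding eq differentiable_def by blast
  then show ?hessian
    unfolding hess_xx_def using jacobian_works by blast
qed

section \<open>Inequalities from the Hessian bounds\<close>

lemma mat_mult_vec: "mat c *v v = c *\<^sub>R v" for v :: "real^'n"
  by (simp add: vec_eq_iff matrix_vector_mult_def mat_def if_distrib[of "\<lambda>z. z * _"] cong: if_cong)

lemma loewner_mat_leD:
  assumes "mat c \<preceq> A"
  shows "c * (norm v)\<^sup>2 \<le> v \<bullet> (A *v v)"
  using assms[unfolded loewner_le_def, rule_format, of v]
  by (simp add: matrix_vector_mult_diff_rdistrib inner_diff_right mat_mult_vec power2_norm_eq_inner)

lemma loewner_le_matD:
  assumes "A \<preceq> mat c"
  shows "v \<bullet> (A *v v) \<le> c * (norm v)\<^sup>2"
  using assms[unfolded loewner_le_def, rule_format, of v]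
  by (simp add: matrix_vector_mult_diff_rdistrib inner_diff_right mat_mult_vec power2_norm_eq_inner)

text \<open>The Hessian bound is applied at the unknown intermediate point of the Taylor expansion,
  which is why it is assumed at every \<open>y\<close>.\<close>

lemma strong_convexity_lower_bound:
  assumes "twice_cont_diff_on UNIV (\<lambda>y. f y s)" "\<And>y. mat m \<preceq> hess_xx f y s"
  shows "f x s + grad_x f x s \<bullet> (y - x) + m / 2 * (norm (y - x))\<^sup>2 \<le> f y s"
proof -
  obtain z where "f y s = f x s + grad_x f x s \<bullet> (y - x) + ((y - x) \<bullet> (hess_xx f z s *v (y - x))) / 2"
    using second_order_taylor_gradient[OF GDERIV_grad_x[where f = f and s = s, OF assms(1)]
        has_derivative_grad_x[where f = f and s = s, OF assms(1)], of y x] by blast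
  then show ?thesis
    using loewner_mat_leD[OF assms(2)[of z], of "y - x"] by simp
qed

lemma smoothness_upper_bound:
  assumes "twice_cont_diff_on UNIV (\<lambda>y. f y s)" "\<And>y. hess_xx f y s \<preceq> mat M"
  shows "f y s \<le> f x s + grad_x f x s \<bullet> (y - x) + M / 2 * (norm (y - x))\<^sup>2"
proof -
  obtain z where "f y s = f x s + grad_x f x s \<bullet> (y - x) + ((y - x) \<bullet> (hess_xx f z s *v (y - x))) / 2"
    using second_order_taylor_gradient[OF GDERIV_grad_x[where f = f and s = s, OF assms(1)]
        has_derivative_grad_x[where f = f and s = s, OF assms(1)], of y x] by blast
  then show ?thesis
    using loewner_le_matD[OF assms(2)[of z], of "y - x"] by simp
qed

text \<open>The step length \<open>c\<close> is left free because both the prediction and the update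
  are gradient steps, with different lengths.\<close>

lemma gradient_step_upper_bound:
  assumes "twice_cont_diff_on UNIV (\<lambda>y. f y s)" "\<And>y. hess_xx f y s \<preceq> mat M"
  shows "f (x - c *\<^sub>R grad_x f x s) s \<le> f x s - c * (1 - c * M / 2) * (norm (grad_x f x s))\<^sup>2"
  using smoothness_upper_bound[OF assms, of "x - c *\<^sub>R grad_x f x s" x]
  by (simp add: power2_norm_eq_inner power2_eq_square[of c] algebra_simps)

text \<open>The quadratic minorant from strong convexity is minimized over the displacement
  \<open>y - x\<close>. The point \<open>y\<close> is arbitrary and later becomes the
  minimizer.\<close>

lemma polyak_lojasiewicz:
  assumes "twice_cont_diff_on UNIV (\<lambda>y. f y s)" "\<And>y. mat m \<preceq> hess_xx f y s" "0 < m"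
  shows "2 * m * (f x s - f y s) \<le> (norm (grad_x f x s))\<^sup>2"
proof -
  define g where "g = grad_x f x s"
  \<comment> \<open>Completing the square: this vector vanishes at \<open>y - x = - g / m\<close>,
    where the minorant is smallest.\<close>
  have "0 \<le> (norm (g + m *\<^sub>R (y - x)))\<^sup>2"
    by simp
  also have "\<dots> = (norm g)\<^sup>2 + 2 * m * (g \<bullet> (y - x) + m / 2 * (norm (y - x))\<^sup>2)"
    unfolding power2_norm_eq_inner by (simp add: inner_commute algebra_simps)
  also have "\<dots> \<le> (norm g)\<^sup>2 + 2 * m * (f y s - f x s)"
    using strong_convexity_lower_bound[OF assms(1,2), of x y] \<open>0 < m\<close>
    by (intro add_left_mono mult_left_mono) (auto simp: g_def)
  finally show ?thesis
    by (simp add: g_def algebra_simps)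
qed

section \<open>Optimal value and variation in time\<close>

text \<open>\<open>arg_min\<close> is a choice operator; existence of a minimizer ensures that the
  chosen point is one.\<close>

lemma f_opt_le:
  assumes "\<exists>y. is_arg_min (\<lambda>z. f z s) (\<lambda>_. True) y"
  shows "f_opt f s \<le> f y s"
  using someI_ex[OF assms] unfolding f_opt_def x_opt_def arg_min_def is_arg_min_def
  by (simp add: not_less)

text \<open>Mean value inequality on the convex set \<open>{0..}\<close>; differentiability within
  that set makes \<open>deriv_t\<close> a true derivative, one-sided at 0.\<close>

lemma abs_diff_time_le:
  assumes "cont_diff_on {0..} (f y)" "\<And>s. 0 \<le> s \<Longrightarrow> \<bar>deriv_t f y s\<bar> \<le> K" "0 \<le> s" "0 \<le> s'"
  shows "\<bar>f y s' - f y s\<bar> \<le> K * \<bar>s' - s\<bar>"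
proof -
  from assms(1) obtain F' where
    F': "\<And>u. 0 \<le> u \<Longrightarrow> (f y has_derivative blinfun_apply (F' u)) (at u within {0..})"
    unfolding cont_diff_on_def by auto
  have "(f y has_field_derivative deriv_t f y u) (at u within {0..})" if "u \<in> {0..}" for u
    using F'[of u] that
    by (auto simp: deriv_t_def has_real_derivative_iff_has_vector_derivative
        vector_derivative_works[symmetric] differentiable_def)
  then show ?thesis
    using field_differentiable_bound[of "{0..}" "f y" "deriv_t f y" K s' s] assms(2-4)
    by simp
qed

section \<open>Effect of one iteration and the error recursion\<close>

text \<open>The predicted step has first-order decrease \<open>\<delta> * d\<close> with
  \<open>d\<close> the size of \<open>deriv_t\<close>, and second-order error
  \<open>M / 2 * d\<^sup>2 * \<delta>\<^sup>2 / N\<^sup>2\<close> with \<open>N\<close> the gradient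
  norm. The threshold gives \<open>\<epsilon> \<le> N\<close>; below it the point does not
  move.\<close>

lemma predict_upper_bound:
  assumes C2: "twice_cont_diff_on UNIV (\<lambda>y. f y s)" and M: "\<And>y. hess_xx f y s \<preceq> mat M"
    and K: "\<bar>deriv_t f x s\<bar> \<le> K" and nonneg: "0 \<le> M" "0 \<le> \<delta>" "0 < \<epsilon>"
  shows "f (predict f \<epsilon> \<delta> x s) s \<le> f x s + M / (2 * \<epsilon>\<^sup>2) * K\<^sup>2 * \<delta>\<^sup>2"
proof (cases "\<epsilon> \<le> norm (grad_x f x s)")
  case True
  define N where "N = norm (grad_x f x s)"
  define d where "d = \<bar>deriv_t f x s\<bar>"
  define c where "c = \<delta> * (d / N\<^sup>2)"
  have N: "0 < N" "\<epsilon> \<le> N"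
    using True \<open>0 < \<epsilon>\<close> by (auto simp: N_def)
  have "f (predict f \<epsilon> \<delta> x s) s \<le> f x s - c * (1 - c * M / 2) * N\<^sup>2"
    using gradient_step_upper_bound[OF C2 M, of x c] True
    by (simp add: predict_def c_def N_def d_def)
  also have "c * (1 - c * M / 2) * N\<^sup>2 = \<delta> * d - M / 2 * d\<^sup>2 * \<delta>\<^sup>2 / N\<^sup>2"
    using N by (simp add: c_def field_simps power2_eq_square)
  \<comment> \<open>The nonnegative decrease \<open>\<delta> * d\<close> is dropped here.\<close>
  also have "f x s - (\<delta> * d - M / 2 * d\<^sup>2 * \<delta>\<^sup>2 / N\<^sup>2) \<le> f x s + M / 2 * d\<^sup>2 * \<delta>\<^sup>2 / N\<^sup>2"
    using nonneg by (simp add: d_def)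
  also have "\<dots> \<le> f x s + M / 2 * K\<^sup>2 * \<delta>\<^sup>2 / \<epsilon>\<^sup>2"
    using nonneg N K by (intro add_left_mono frac_le mult_right_mono mult_left_mono power_mono)
      (auto simp: d_def)
  finally show ?thesis
    by simp
qed (use nonneg in \<open>simp add: predict_def\<close>)

text \<open>The guaranteed decrease is a multiple of the squared gradient norm, which the
  Polyak-Lojasiewicz inequality bounds below by the gap; \<open>\<alpha> * M \<le> 2\<close> keeps
  that multiple nonnegative.\<close>

lemma update_gap_le:
  assumes C2: "twice_cont_diff_on UNIV (\<lambda>y. f y s)"
    and m: "\<And>y. mat m \<preceq> hess_xx f y s" and M: "\<And>y. hess_xx f y s \<preceq> mat M"
    and "0 < m" "0 \<le> \<alpha>" "\<alpha> * M \<le> 2"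
  shows "f (update f \<alpha> x s) s - f y s \<le> (1 - 2 * (1 - \<alpha> * M / 2) * \<alpha> * m) * (f x s - f y s)"
proof -
  have "\<alpha> * (1 - \<alpha> * M / 2) * (2 * m * (f x s - f y s))
      \<le> \<alpha> * (1 - \<alpha> * M / 2) * (norm (grad_x f x s))\<^sup>2"
    using assms by (intro mult_left_mono polyak_lojasiewicz) auto
  then show ?thesis
    using gradient_step_upper_bound[OF C2 M, of x \<alpha>] by (simp add: update_def algebra_simps)
qed

text \<open>The map \<open>e \<mapsto> r * (e + c)\<close> has fixed point
  \<open>r * c / (1 - r)\<close>. The constant \<open>c / (1 - r)\<close> exceeds it by
  \<open>c\<close>, so the induction step has slack \<open>c * (1 - r)\<close>.\<close>

lemma affine_recursion_bound:
  fixes e :: "nat \<Rightarrow> real"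
  assumes "\<And>k. e (Suc k) \<le> r * (e k + c)" "0 \<le> r" "r < 1" "0 \<le> c"
  shows "e k \<le> r ^ k * e 0 + c / (1 - r)"
proof (induction k)
  case (Suc k)
  have "e (Suc k) \<le> r * (r ^ k * e 0 + c / (1 - r) + c)"
    using assms(1)[of k] Suc \<open>0 \<le> r\<close> by (meson add_right_mono mult_left_mono order_trans)
  also have "\<dots> = r ^ Suc k * e 0 + c / (1 - r) - c * (1 - r)"
    using \<open>r < 1\<close> by (simp add: divide_simps) algebra
  finally show ?case
    using assms(3,4) by (smt (verit) mult_nonneg_nonneg)
qed (use assms in simp)

theorem mainTheorem1:
  fixes f :: "real^'n \<Rightarrow> real \<Rightarrow> real"
    and x0 :: "real^'n"
    and m M K1 K2 K3 \<delta> \<epsilon> \<alpha> t0 \<kappa> \<psi> \<gamma> \<mu> :: real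
    and x :: "nat \<Rightarrow> real^'n"
    and t :: "nat \<Rightarrow> real"
    and k :: nat
  assumes solvable: "\<forall>s\<ge>0. \<exists>y. is_arg_min (\<lambda>z. f z s) (\<lambda>_. True) y"
    and C2_x: "\<forall>s\<ge>0. twice_cont_diff_on UNIV (\<lambda>y. f y s)"
    and C1_t: "\<forall>y. cont_diff_on {0..} (f y)"
    and Lipschitz_t: "\<exists>L. \<forall>y. L-lipschitz_on {0..} (f y)"
    and hess_lower: "\<forall>y. \<forall>s\<ge>0. mat m \<preceq> hess_xx f y s"
    and hess_upper: "\<forall>y. \<forall>s\<ge>0. hess_xx f y s \<preceq> mat M"
    and C2_joint: "twice_cont_diff_on (UNIV \<times> {0..}) (\<lambda>(y, s). f y s)"
    and bound_t: "\<forall>y. \<forall>s\<ge>0. \<bar>deriv_t f y s\<bar> \<le> K1"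
    and bound_xt: "\<forall>y. \<forall>s\<ge>0. norm (deriv_xt f y s) \<le> K2"
    and bound_tt: "\<forall>y. \<forall>s\<ge>0. \<bar>deriv_tt f y s\<bar> \<le> K3"
    and "0 < m" and "m \<le> M"
    and "0 \<le> K1" and "0 \<le> K2" and "0 \<le> K3"
    and "0 < \<delta>" and "0 < \<epsilon>"
    and "0 < \<alpha>" and "\<alpha> \<le> 1 / (2 * M)"
    and "0 \<le> t0"
    and t_def: "t = sample_time t0 \<delta>"
    and x_def: "x = iterate f \<epsilon> \<delta> \<alpha> t0 x0"
    and kappa_def: "\<kappa> = 1 - \<alpha> * M / 2"
    and psi_def: "\<psi> = \<delta> * (K1 + \<delta> / 2 * K3)
                      + K2\<^sup>2 * \<delta>\<^sup>2 / (2 * m) * (M * \<delta> / m + 2)"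
    and gamma_def: "\<gamma> = 2 * K1 / \<delta> + M / (2 * \<epsilon>\<^sup>2) * K1\<^sup>2 + 1 / 2 * K3 + 1 / \<epsilon> * K1 * K2"
    and mu_def: "\<mu> = K1 + \<delta> / 2 * K3"
    and "1 \<le> k"
  shows "f (x (k + 1)) (t (k + 1)) - f_opt f (t (k + 1))
         \<le> (1 - (1 - 2 * \<kappa> * \<alpha> * m) ^ k) / (4 * \<kappa>\<^sup>2 * \<alpha>\<^sup>2 * m) * \<psi>
           + (1 - (1 - 2 * \<kappa> * \<alpha> * m) ^ k) / (4 * \<kappa>\<^sup>2 * \<alpha>\<^sup>2 * m\<^sup>2) * max (\<gamma> * \<delta>\<^sup>2) (\<mu> * \<delta>)
           + (1 - 2 * \<kappa> * \<alpha> * m) ^ k * (f x0 t0 - f_opt f t0)"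
proof -
  define \<rho> where "\<rho> = 1 - 2 * \<kappa> * \<alpha> * m"
  \<comment> \<open>One \<open>K1 * \<delta>\<close> pays for the drift of \<open>f\<close>, the
    other for that of \<open>f_opt\<close>; the last term is the cost of prediction.\<close>
  define c where "c = 2 * K1 * \<delta> + M / (2 * \<epsilon>\<^sup>2) * K1\<^sup>2 * \<delta>\<^sup>2"
  define e where "e k = f (x k) (t k) - f_opt f (t k)" for k
  have "0 < M"
    using \<open>0 < m\<close> \<open>m \<le> M\<close> by simp
  have \<alpha>M: "\<alpha> * M \<le> 1 / 2"
    using \<open>\<alpha> \<le> 1 / (2 * M)\<close> \<open>0 < M\<close> by (simp add: field_simps)
  have \<kappa>: "3 / 4 \<le> \<kappa>" "\<kappa> \<le> 1"
    using \<alpha>M mult_pos_pos[OF \<open>0 < \<alpha>\<close> \<open>0 < M\<close>] unfolding kappa_def by linarith+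
  \<comment> \<open>With \<open>\<alpha> * M \<le> 1 / 2\<close> this gives
    \<open>2 * \<kappa> * \<alpha> * m \<le> 1\<close>, so the contraction factor is
    nonnegative.\<close>
  have "\<kappa> * (\<alpha> * m) \<le> 1 * (\<alpha> * M)"
    using \<kappa> \<open>0 < \<alpha>\<close> \<open>0 < m\<close> \<open>m \<le> M\<close> by (intro mult_mono) auto
  with \<alpha>M have "0 \<le> \<rho>"
    by (simp add: \<rho>_def mult.assoc)
  have "\<rho> < 1"
    using \<kappa> \<open>0 < \<alpha>\<close> \<open>0 < m\<close> by (simp add: \<rho>_def)
  have t_nonneg: "0 \<le> t k" for k
    using \<open>0 \<le> t0\<close> \<open>0 < \<delta>\<close> by (simp add: t_def sample_time_def)
  have t_Suc: "t (Suc k) = t k + \<delta>" for k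
    by (simp add: t_def sample_time_def algebra_simps)
  have gap: "0 \<le> f y s - f_opt f s" if "0 \<le> s" for y s
    using f_opt_le[of f s y] solvable that by simp
  have time: "\<bar>f y (t (Suc k)) - f y (t k)\<bar> \<le> K1 * \<delta>" for y k
    using abs_diff_time_le[of f y K1 "t k" "t (Suc k)"] C1_t bound_t t_nonneg \<open>0 < \<delta>\<close>
    by (simp add: t_Suc)
  have "e (Suc k) \<le> \<rho> * (e k + c)" for k
  proof -
    define y where "y = predict f \<epsilon> \<delta> (x k) (t k)"
    have "f y (t (Suc k)) \<le> f y (t k) + K1 * \<delta>"
      using time[of y k] by simp
    also have "f y (t k) \<le> f (x k) (t k) + M / (2 * \<epsilon>\<^sup>2) * K1\<^sup>2 * \<delta>\<^sup>2"
      unfolding y_def using C2_x hess_upper bound_t t_nonneg \<open>0 < M\<close> \<open>0 < \<delta>\<close> \<open>0 < \<epsilon>\<close>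
      by (intro predict_upper_bound) auto
    finally have predicted: "f y (t (Suc k)) \<le> f (x k) (t k) + M / (2 * \<epsilon>\<^sup>2) * K1\<^sup>2 * \<delta>\<^sup>2 + K1 * \<delta>"
      by simp
    \<comment> \<open>The minimizer at the new time serves as a competitor at the old time, so no
      bound on the motion of the minimizer enters.\<close>
    have "f_opt f (t k) \<le> f_opt f (t (Suc k)) + K1 * \<delta>"
      using gap[OF t_nonneg[of k], of "x_opt f (t (Suc k))"] time[of "x_opt f (t (Suc k))" k]
      by (simp add: f_opt_def)
    with predicted have "f y (t (Suc k)) - f_opt f (t (Suc k)) \<le> e k + c"
      by (simp add: e_def c_def)
    moreover have "e (Suc k) \<le> \<rho> * (f y (t (Suc k)) - f_opt f (t (Suc k)))"
    proof -
      have "x (Suc k) = update f \<alpha> y (t (Suc k))"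
        by (simp add: x_def t_def y_def)
      then show ?thesis
        \<comment> \<open>Unfolding \<open>f_opt\<close> exposes the minimizer as the comparison
          point of \<open>update_gap_le\<close>.\<close>
        unfolding e_def \<rho>_def kappa_def f_opt_def
        using C2_x hess_lower hess_upper t_nonneg \<open>0 < m\<close> \<open>0 < \<alpha>\<close> \<alpha>M
        by (simp only:) (rule update_gap_le; simp)
    qed
    ultimately show ?thesis
      using \<open>0 \<le> \<rho>\<close> by (meson mult_left_mono order_trans)
  qed
  moreover have "0 \<le> c"
    using \<open>0 \<le> K1\<close> \<open>0 < \<delta>\<close> \<open>0 < M\<close> by (simp add: c_def)
  ultimately have "e (k + 1) \<le> \<rho> ^ (k + 1) * e 0 + c / (1 - \<rho>)"
    using affine_recursion_bound \<open>0 \<le> \<rho>\<close> \<open>\<rho> < 1\<close> by blast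
  \<comment> \<open>The recursion yields exponent \<open>k + 1\<close>; since \<open>e 0\<close> is
    nonnegative, it may be lowered to the claimed \<open>k\<close>.\<close>
  also have "\<rho> ^ (k + 1) * e 0 \<le> \<rho> ^ k * e 0"
    using \<open>0 \<le> \<rho>\<close> \<open>\<rho> < 1\<close> gap[OF t_nonneg]
    by (intro mult_right_mono power_decreasing) (auto simp: e_def)
  also have "c / (1 - \<rho>) \<le> (1 - \<rho> ^ k) / (4 * \<kappa>\<^sup>2 * \<alpha>\<^sup>2 * m\<^sup>2) * max (\<gamma> * \<delta>\<^sup>2) (\<mu> * \<delta>)"
  proof -
    \<comment> \<open>\<open>c\<close> is the contribution of the first two summands of
      \<open>\<gamma>\<close>; the other two are nonnegative.\<close>
    have "\<gamma> * \<delta>\<^sup>2 = c + 1 / 2 * K3 * \<delta>\<^sup>2 + 1 / \<epsilon> * K1 * K2 * \<delta>\<^sup>2"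
      using \<open>0 < \<delta>\<close> by (simp add: gamma_def c_def algebra_simps power2_eq_square)
    then have "c \<le> max (\<gamma> * \<delta>\<^sup>2) (\<mu> * \<delta>)"
      using \<open>0 \<le> K1\<close> \<open>0 \<le> K2\<close> \<open>0 \<le> K3\<close> \<open>0 < \<epsilon>\<close> by (simp add: le_max_iff_disj)
    \<comment> \<open>Here \<open>1 \<le> k\<close> is essential: at \<open>k = 0\<close> the factor
      \<open>1 - \<rho> ^ k\<close> would vanish.\<close>
    moreover have "\<rho> ^ k \<le> \<rho>"
      using \<open>1 \<le> k\<close> \<open>0 \<le> \<rho>\<close> \<open>\<rho> < 1\<close> power_decreasing[of 1 k \<rho>] by simp
    then have "1 / (1 - \<rho>) \<le> (1 - \<rho> ^ k) / (1 - \<rho>)\<^sup>2"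
      using divide_right_mono[of "1 - \<rho>" "1 - \<rho> ^ k" "(1 - \<rho>)\<^sup>2"]
      by (simp add: power2_eq_square split: if_splits)
    ultimately have "1 / (1 - \<rho>) * c \<le> (1 - \<rho> ^ k) / (1 - \<rho>)\<^sup>2 * max (\<gamma> * \<delta>\<^sup>2) (\<mu> * \<delta>)"
      using \<open>0 \<le> c\<close> \<open>\<rho> ^ k \<le> \<rho>\<close> \<open>\<rho> < 1\<close> by (intro mult_mono) auto
    moreover have "(1 - \<rho>)\<^sup>2 = 4 * \<kappa>\<^sup>2 * \<alpha>\<^sup>2 * m\<^sup>2"
      by (simp add: \<rho>_def power_mult_distrib)
    ultimately show ?thesis
      by simp
  qed
  finally have "e (k + 1) \<le> \<rho> ^ k * e 0
      + (1 - \<rho> ^ k) / (4 * \<kappa>\<^sup>2 * \<alpha>\<^sup>2 * m\<^sup>2) * max (\<gamma> * \<delta>\<^sup>2) (\<mu> * \<delta>)"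
    by simp
  \<comment> \<open>Nonnegativity allows this summand to be added to the bound just
    obtained.\<close>
  moreover have "0 \<le> (1 - \<rho> ^ k) / (4 * \<kappa>\<^sup>2 * \<alpha>\<^sup>2 * m) * \<psi>"
  proof -
    have "0 \<le> \<psi>"
      unfolding psi_def using \<open>0 \<le> K1\<close> \<open>0 \<le> K3\<close> \<open>0 < \<delta>\<close> \<open>0 < m\<close> \<open>0 < M\<close>
      by (intro add_nonneg_nonneg mult_nonneg_nonneg divide_nonneg_nonneg) auto
    moreover have "\<rho> ^ k \<le> 1"
      using \<open>0 \<le> \<rho>\<close> \<open>\<rho> < 1\<close> by (simp add: power_le_one)
    ultimately show ?thesis
      using \<open>0 < m\<close> by simp
  qed
  ultimately show ?thesis
    by (simp add: e_def \<rho>_def x_def t_def sample_time_def)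
qed

end
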